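(* Let $G$ be a nontrivial finite Abelian group. If $G\cong\mathbb{Z}_4$, then $\mathcal{L}(G)$ is not well-rounded; for every other nontrivial finite Abelian group $G$, the lattice $\mathcal{L}(G)$ is well-rounded. Moreover, the minimum distance satisfies $d(\mathbb{Z}_2)=\sqrt{8}$, $d(\mathbb{Z}_3)=\sqrt{6}$, and $d(G)=2$ for every finite Abelian group $G$ not isomorphic to the trivial group, $\mathbb{Z}_2$ or $\mathbb{Z}_3$.
   Context: Let $G=\{0,g_1,\dots,g_n\}$ be a finite Abelian (additive) group of order $n+1$, with its nonzero elements listed as $g_1,\dots,g_n$. Define the lattice $$\mathcal{L}(G)=\Big\{X=(x_1,\dots,x_n,-x_1-\cdots-x_n)\in\mathbb{Z}^{n+1}:\ x_1g_1+\cdots+x_ng_n=0\Big\},$$ a sublattice of full rank $n$ of the root lattice $\mathcal{A}_n=\{(x_1,\dots,x_n,-x_1-\cdots-x_n)\in\mathbb{Z}^{n+1}\}$ (changing the listing of the $g_i$ only permutes coordinates). Let $\|\cdot\|$ be the Euclidean norm, $d(G)=\min\{\|X\|: X\in\mathcal{L}(G)\setminus\{0\}\}$ the minimum distance, and $\mathcal{S}(G)$ the set of $X\in\mathcal{L}(G)$ with $\|X\|=d(G)$ (minimal vectors). The lattice $\mathcal{L}(G)$ is called well-rounded if $\mathcal{S}(G)$ contains $n$ linearly independent vectors. $\mathbb{Z}_m$ denotes the cyclic group of order $m$. *)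

theory Defs
  imports "HOL-Algebra.Elementary_Groups" "Jordan_Normal_Form.VS_Connect"
begin

text \<open>
  The finite Abelian group is a HOL-Algebra group \<open>G\<close>, hence written multiplicatively: the additive
  relation \<open>x\<^sub>1 g\<^sub>1 + \<dots> + x\<^sub>n g\<^sub>n = 0\<close> is the finite product of the integer powers being \<open>\<one>\<close>.
  The listing \<open>g\<^sub>1, \<dots>, g\<^sub>n\<close> of the elements other than the identity is an explicit list \<open>gs\<close>,
  so \<open>n = length gs\<close>, and coordinates are indexed from \<open>0\<close>. Lattice vectors are real vectors of
  dimension \<open>n + 1\<close> with integral entries.
\<close>

definition lists_nonzero :: "('a, 'b) monoid_scheme \<Rightarrow> 'a list \<Rightarrow> bool" where
  "lists_nonzero G gs \<longleftrightarrow> distinct gs \<and> set gs = carrier G - {\<one>\<^bsub>G\<^esub>}"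

definition group_lattice :: "('a, 'b) monoid_scheme \<Rightarrow> 'a list \<Rightarrow> real vec set" where
  "group_lattice G gs =
    {vec (length gs + 1)
       (\<lambda>i. real_of_int (if i < length gs then x i else - (\<Sum>j<length gs. x j))) | x :: nat \<Rightarrow> int.
       (\<Otimes>\<^bsub>G\<^esub>i\<in>{..<length gs}. (gs ! i) [^]\<^bsub>G\<^esub> x i) = \<one>\<^bsub>G\<^esub>}"

definition euclidean_norm :: "real vec \<Rightarrow> real" where
  "euclidean_norm X = sqrt (scalar_prod X X)"

text \<open>\<open>LEAST\<close> rather than an infimum, because the minimum distance is an attained minimum.\<close>

definition min_distance :: "('a, 'b) monoid_scheme \<Rightarrow> 'a list \<Rightarrow> real" where
  "min_distance G gs =
    (LEAST r. r \<in> euclidean_norm ` (group_lattice G gs - {0\<^sub>v (length gs + 1)}))"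

definition minimal_vectors :: "('a, 'b) monoid_scheme \<Rightarrow> 'a list \<Rightarrow> real vec set" where
  "minimal_vectors G gs = {X \<in> group_lattice G gs. euclidean_norm X = min_distance G gs}"

definition well_rounded :: "('a, 'b) monoid_scheme \<Rightarrow> 'a list \<Rightarrow> bool" where
  "well_rounded G gs \<longleftrightarrow>
    (\<exists>B \<subseteq> minimal_vectors G gs. finite B \<and> card B = length gs \<and>
       LinearCombinations.module.lin_indpt class_ring (module_vec TYPE(real) (length gs + 1)) B)"

end

theory Submission
  imports Defs "HOL-Algebra.Multiplicative_Group"
begin

text \<open>
  A lattice vector is an integer weight \<open>y\<close> on \<open>G\<close> of total weight zero such that the product of
  the powers of \<open>g\<close> with exponents \<open>y g\<close> is trivial. Its squared norm is even, and the value 2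
  would force \<open>y\<close> to be \<open>1\<close> at \<open>a\<close>, \<open>-1\<close> at \<open>b\<close> and \<open>0\<close> elsewhere, whence \<open>a = b\<close>; so 4 is the
  least conceivable value. It is attained by the weights \<open>1\<close> at \<open>a, b\<close> and \<open>-1\<close> at \<open>c, d\<close> for
  distinct \<open>a, b, c, d\<close> with \<open>a b = c d\<close>.

  Well-roundedness is tested by duality: the minimal vectors span the hyperplane of total weight
  zero iff every function \<open>F\<close> on \<open>G\<close> orthogonal to all of them is constant. If
  \<open>F a + F b = F c + F d\<close> for all quadruples as above and \<open>F\<close> is maximal at \<open>m\<close>, then
  \<open>f x = F (m x) - F m \<le> 0\<close> satisfies \<open>f (x y) = f x + f y\<close> for \<open>x, y\<close> distinct, nontrivial and
  not mutually inverse. Where \<open>f\<close> takes a negative minimum, at \<open>z\<close> say, this forces every element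
  to be one of \<open>1\<close>, \<open>z\<close>, the inverse of \<open>z\<close> and its square; so \<open>G\<close> has fewer than four elements
  or is cyclic of order 4. In the latter case all minimal vectors lie in a plane.
\<close>

section \<open>Linear algebra\<close>

text \<open>Together with the coordinate sum, fewer than \<open>n\<close> vectors impose at most
  \<open>n\<close> linear conditions in dimension \<open>n + 1\<close>.\<close>

lemma exists_orthogonal_vec:
  fixes B :: "real vec set"
  assumes "finite B" "card B < n" "B \<subseteq> carrier_vec (Suc n)"
  obtains F where "F \<in> carrier_vec (Suc n)" "F \<noteq> 0\<^sub>v (Suc n)" "\<And>X. X \<in> B \<Longrightarrow> X \<bullet> F = 0"
    "(\<Sum>i<Suc n. F $ i) = 0"
proof -
  obtain bs where bs: "set bs = B" "length bs = card B"
    using assms(1) distinct_card finite_distinct_list by metis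
  define one where "one = (vec (Suc n) (\<lambda>_. 1) :: real vec)"
  \<comment> \<open>The rows from \<open>card B\<close> to \<open>n\<close> all equal
    \<open>one\<close>. Since \<open>card B < n\<close> there are at least two of them, so this
    square matrix is singular.\<close>
  define A where "A = mat_of_rows (Suc n) (map (\<lambda>i. if i < card B then bs ! i else one) [0..<Suc n])"
  have A: "A \<in> carrier_mat (Suc n) (Suc n)" by (simp add: A_def mat_of_rows_def)
  have rowA: "row A i = (if i < card B then bs ! i else one)" if "i < Suc n" for i
  proof -
    have "(if i < card B then bs ! i else one) \<in> carrier_vec (Suc n)"
      using assms(3) bs by (auto simp: one_def)
    then show ?thesis unfolding A_def using that
      by (subst mat_of_rows_row) (auto simp: nth_append simp del: upt_Suc)
  qed
  have "det A = 0"
    by (rule det_identical_rows[OF A, of "card B" n]) (use assms(2) rowA in auto)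
  then obtain F where F: "F \<in> carrier_vec (Suc n)" "F \<noteq> 0\<^sub>v (Suc n)" "A *\<^sub>v F = 0\<^sub>v (Suc n)"
    using det_0_iff_vec_prod_zero[OF A] by blast
  have eq: "row A i \<bullet> F = 0" if "i < Suc n" for i
    using arg_cong[OF F(3), of "\<lambda>v. v $ i"] that A by auto
  show ?thesis
  proof (rule that[OF F(1,2)])
    fix X assume "X \<in> B"
    then obtain i where "i < card B" "X = bs ! i" using bs by (metis in_set_conv_nth)
    then show "X \<bullet> F = 0" using eq[of i] rowA[of i] assms(2) by auto
  next
    show "(\<Sum>i<Suc n. F $ i) = 0"
      using eq[of n] rowA[of n] assms(2) F(1)
      by (auto simp: one_def scalar_prod_def lessThan_atLeast0)
  qed
qed

context vec_space
begin

lemma scalar_prod_span_eq_0: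
  assumes "B \<subseteq> carrier_vec n" "F \<in> carrier_vec n" "\<And>X. X \<in> B \<Longrightarrow> X \<bullet> F = 0" "Y \<in> span B"
  shows "Y \<bullet> F = 0"
proof -
  from assms(4) obtain a C where C: "finite C" "C \<subseteq> B" "Y = lincomb a C"
    unfolding span_def by auto
  have "Y \<bullet> F = (\<Sum>v\<in>C. (a v \<cdot>\<^sub>v v) \<bullet> F)"
    unfolding C(3) lincomb_def using assms C by (intro finsum_scalar_prod_sum) auto
  also have "\<dots> = 0"
  proof (rule sum.neutral, rule ballI)
    fix v assume "v \<in> C"
    then have "v \<in> carrier_vec n" "v \<bullet> F = 0" using assms C by auto
    then show "(a v \<cdot>\<^sub>v v) \<bullet> F = 0" using assms(2) by simp
  qed
  finally show ?thesis .
qed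

text \<open>Excludes opposite vectors from an independent set; \<open>X \<noteq> - X\<close> ensures
  that the sum over the pair has two terms.\<close>

lemma lin_dep_if_uminus_mem:
  assumes "X \<in> B" "- X \<in> B" "X \<noteq> - X" "X \<in> carrier_vec n"
  shows "lin_dep B"
proof (rule lin_dep_crit[where A = "{X, - X}" and a = "\<lambda>_. 1" and v = X])
  show "lincomb (\<lambda>_. 1) {X, - X} = 0\<^sub>v n"
    unfolding lincomb_def using assms by (subst finsum_insert) auto
qed (use assms in auto)

end

text \<open>Greedy choice: while fewer than \<open>n\<close> vectors are chosen, a nonzero
  \<open>F\<close> of coordinate sum zero is orthogonal to them. Such an \<open>F\<close> is not
  constant, so some vector of \<open>S\<close> is not orthogonal to it and lies outside the
  span.\<close>

lemma exists_lin_indpt_if_annihilator_const: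
  fixes S :: "real vec set"
  assumes S: "S \<subseteq> carrier_vec (Suc n)"
    and ann: "\<And>F. F \<in> carrier_vec (Suc n) \<Longrightarrow> (\<And>X. X \<in> S \<Longrightarrow> X \<bullet> F = 0)
      \<Longrightarrow> \<exists>c. \<forall>i<Suc n. F $ i = c"
  shows "\<exists>B\<subseteq>S. finite B \<and> card B = n
    \<and> LinearCombinations.module.lin_indpt class_ring (module_vec TYPE(real) (Suc n)) B"
proof -
  interpret vec_space "TYPE(real)" "Suc n" .
  have "\<exists>B\<subseteq>S. finite B \<and> card B = k \<and> lin_indpt B" if "k \<le> n" for k
    using that
  proof (induction k)
    case 0
    then show ?case by (intro exI[of _ "{}"]) (auto simp: lin_dep_def)
  next
    case (Suc k)
    then obtain B where B: "B \<subseteq> S" "finite B" "card B = k" "lin_indpt B" by auto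
    obtain F where F: "F \<in> carrier_vec (Suc n)" "F \<noteq> 0\<^sub>v (Suc n)"
        "\<And>X. X \<in> B \<Longrightarrow> X \<bullet> F = 0" "(\<Sum>i<Suc n. F $ i) = 0"
      using exists_orthogonal_vec[of B n] B S Suc.prems by auto
    have "\<exists>X\<in>S. X \<bullet> F \<noteq> 0"
    proof (rule ccontr)
      assume "\<not> ?thesis"
      then obtain c where c: "\<forall>i<Suc n. F $ i = c" using ann[OF F(1)] by blast
      then have "real (Suc n) * c = 0" using F(4) by simp
      then have "c = 0" by simp
      then show False using c F(1,2) by auto
    qed
    then obtain X where X: "X \<in> S" "X \<bullet> F \<noteq> 0" by blast
    have notin: "X \<notin> span B" using scalar_prod_span_eq_0[of B F X] B S F X by blast
    have "X \<notin> B" using F(3) X(2) by blast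
    then have "lin_indpt (B \<union> {X})"
      using lin_dep_iff_in_span[of B X] B S X notin by auto
    then show ?case using B X \<open>X \<notin> B\<close>
      by (intro exI[of _ "B \<union> {X}"]) auto
  qed
  then show ?thesis by auto
qed

section \<open>Finite abelian groups\<close>

text \<open>Powers of \<open>x\<close> depend only on the exponent modulo the order; those with
  exponents below it are distinct and, by counting, exhaust the group.\<close>

lemma (in group) iso_integer_mod_group_if_ord:
  assumes x: "x \<in> carrier G" and fin: "finite (carrier G)" and o: "ord x = Coset.order G"
  shows "G \<cong> integer_mod_group (Coset.order G)"
proof -
  define n where "n = Coset.order G"
  have n: "n > 0" using fin by (simp add: n_def order_gt_0_iff_finite)
  let ?h = "\<lambda>k::int. x [^] k"
  have eq: "?h a = ?h b \<longleftrightarrow> int n dvd a - b" for a b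
    using int_pow_eq[OF x] o by (auto simp: n_def dvd_diff_commute)
  have carr: "carrier (integer_mod_group n) = {0..<int n}"
    using n by (simp add: carrier_integer_mod_group)
  have inj: "inj_on ?h {0..<int n}"
    unfolding inj_on_def eq by (auto simp: mod_eq_dvd_iff[symmetric])
  have "?h ` {0..<int n} = carrier G"
    by (rule card_subset_eq) (use fin x inj in \<open>auto simp: card_image n_def Coset.order_def\<close>)
  then have "bij_betw ?h (carrier (integer_mod_group n)) (carrier G)"
    using inj by (simp add: bij_betw_def carr)
  moreover have "?h \<in> hom (integer_mod_group n) G"
  proof (rule homI)
    fix a b
    show "?h (a \<otimes>\<^bsub>integer_mod_group n\<^esub> b) = ?h a \<otimes> ?h b"
      unfolding int_pow_mult[OF x, symmetric] eq by (simp add: mod_eq_dvd_iff[symmetric])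
  qed (use x in auto)
  ultimately have "integer_mod_group n \<cong> G" by (auto simp: is_iso_def iso_def)
  then show ?thesis unfolding n_def using group.iso_sym group_integer_mod_group by blast
qed

lemma (in group) order_iso_integer_mod_group:
  assumes "G \<cong> integer_mod_group n" "n > 0"
  shows "Coset.order G = n"
  using iso_same_card[OF assms(1)] assms(2) by (simp add: Coset.order_def carrier_integer_mod_group)

lemma cyclic_integer_mod_group:
  assumes "n > 1" shows "cyclic_group (integer_mod_group n)"
proof -
  have "1 \<in> carrier (integer_mod_group n)" using assms by simp
  moreover have "carrier (integer_mod_group n) = range (\<lambda>k::int. 1 [^]\<^bsub>integer_mod_group n\<^esub> k)"
  proof -
    have "k \<in> range (\<lambda>k. k mod int n)" if "0 \<le> k" "k < int n" for k
      by (rule range_eqI[of _ _ k]) (use that in simp)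
    then show ?thesis using assms
      by (auto simp: carrier_integer_mod_group int_pow_integer_mod_group)
  qed
  ultimately show ?thesis using group.cyclic_group[OF group_integer_mod_group] by blast
qed

text \<open>Supplies the generator on which the computations for orders 2, 3 and 4 rest.\<close>

lemma (in group) obtain_generator:
  assumes "G \<cong> integer_mod_group n" "n > 1"
  obtains x where "x \<in> carrier G" "ord x = Coset.order G" "Coset.order G = n"
proof -
  have n: "Coset.order G = n" using order_iso_integer_mod_group assms by auto
  have "cyclic_group G"
    using isomorphic_group_cyclicity[OF assms(1)] cyclic_integer_mod_group[OF assms(2)] by auto
  then obtain x where x: "x \<in> carrier G" "subgroup_generated G {x} = G"
    by (auto simp: cyclic_group_def)
  show ?thesis using that[OF x(1)] cyclic_order_is_ord[OF x(1)] x(2) n by simp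
qed

text \<open>By Lagrange every nontrivial element generates. This settles orders 2 and 3.\<close>

lemma (in group) iso_integer_mod_group_if_prime_order:
  assumes "prime (Coset.order G)" shows "G \<cong> integer_mod_group (Coset.order G)"
proof -
  have fin: "finite (carrier G)" using prime_gt_0_nat[OF assms] order_gt_0_iff_finite by simp
  have "carrier G \<noteq> {\<one>}" using assms by (auto simp: Coset.order_def)
  then obtain x where x: "x \<in> carrier G" "x \<noteq> \<one>" using one_closed by blast
  have "ord x = Coset.order G"
    using ord_dvd_group_order[OF x(1)] ord_eq_1[OF x(1)] x(2) assms prime_nat_iff by auto
  then show ?thesis using iso_integer_mod_group_if_ord x fin by blast
qed

text \<open>The combinatorial core, needed twice: for the existence of such quadruples, and for the
  spanning property of the vectors they yield.\<close>

lemma (in comm_group) const_if_balanced_on_quads: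
  fixes F :: "'a \<Rightarrow> real"
  assumes fin: "finite (carrier G)" and card: "Coset.order G \<ge> 4"
    and not4: "\<not> G \<cong> integer_mod_group 4"
    and quad: "\<And>a b c d. \<lbrakk>{a, b, c, d} \<subseteq> carrier G; distinct [a, b, c, d]; a \<otimes> b = c \<otimes> d\<rbrakk>
      \<Longrightarrow> F a + F b = F c + F d"
  shows "\<exists>c. \<forall>g\<in>carrier G. F g = c"
proof -
  obtain m where m: "m \<in> carrier G" "\<And>g. g \<in> carrier G \<Longrightarrow> F g \<le> F m"
  proof -
    have "Max (F ` carrier G) \<in> F ` carrier G" using fin one_closed by (intro Max_in) auto
    then show ?thesis using that fin by (metis Max_ge finite_imageI image_eqI image_iff)
  qed
  define f where "f x = F (m \<otimes> x) - F m" for x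
  have f_le: "f x \<le> 0" if "x \<in> carrier G" for x using m that by (simp add: f_def)
  \<comment> \<open>The side conditions are what makes \<open>m\<close>,
    \<open>m \<otimes> x\<close>, \<open>m \<otimes> y\<close> and
    \<open>m \<otimes> (x \<otimes> y)\<close> distinct.\<close>
  have add: "f (x \<otimes> y) = f x + f y"
    if "x \<in> carrier G" "y \<in> carrier G" "x \<noteq> y" "x \<noteq> \<one>" "y \<noteq> \<one>" "y \<noteq> inv x" for x y
  proof -
    have "x \<otimes> y \<noteq> \<one>" using that by (metis inv_equality inv_inv m_comm)
    moreover have "m \<otimes> x \<otimes> (m \<otimes> y) = m \<otimes> (m \<otimes> (x \<otimes> y))"
      using m that by (simp add: m_ac)
    ultimately have "F (m \<otimes> x) + F (m \<otimes> y) = F m + F (m \<otimes> (x \<otimes> y))"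
      using that m by (intro quad) (auto simp: l_cancel_one' r_cancel_one' l_cancel_one r_cancel_one)
    then show ?thesis by (simp add: f_def)
  qed
  have "f x = 0" if x0: "x \<in> carrier G" for x
  proof (rule ccontr)
    assume "f x \<noteq> 0"
    obtain z where z: "z \<in> carrier G" "\<And>g. g \<in> carrier G \<Longrightarrow> f z \<le> f g"
    proof -
      have "Min (f ` carrier G) \<in> f ` carrier G" using fin one_closed by (intro Min_in) auto
      then show ?thesis using that fin by (metis Min_le finite_imageI image_eqI image_iff)
    qed
    have fz: "f z < 0" using z(2)[OF x0] f_le[OF x0] \<open>f x \<noteq> 0\<close> by linarith
    have z1: "z \<noteq> \<one>" using fz m(1) by (auto simp: f_def)
    have y: "y = inv z \<otimes> inv z" if y: "y \<in> carrier G" "y \<notin> {\<one>, z, inv z}" for y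
    proof -
      have s: "f (z \<otimes> y) = f z + f y" using y z z1 by (intro add) auto
      \<comment> \<open>Minimality of \<open>f z\<close> gives \<open>f y \<ge> 0\<close>, and
        \<open>f\<close> is nowhere positive.\<close>
      then have "f y = 0" using z(2)[of "z \<otimes> y"] f_le[of y] y z(1) by auto
      then have fzy: "f (z \<otimes> y) = f z" using s by simp
      have "z \<otimes> y \<in> {\<one>, z, inv z}"
      proof (rule ccontr)
        assume a: "z \<otimes> y \<notin> {\<one>, z, inv z}"
        \<comment> \<open>A second use of \<open>add\<close> would produce the value
          \<open>2 * f z\<close>, below the minimum.\<close>
        have "f (z \<otimes> (z \<otimes> y)) = f z + f (z \<otimes> y)" using y z z1 a by (intro add) auto
        then show False using fzy fz z(2)[of "z \<otimes> (z \<otimes> y)"] y z(1) by auto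
      qed
      moreover have "z \<otimes> y \<noteq> \<one>" using y z(1) by (metis insertCI inv_equality inv_inv m_comm)
      moreover have "z \<otimes> y \<noteq> z" using y z(1) by auto
      ultimately have "z \<otimes> y = inv z" by simp
      then show ?thesis using y z(1) by (metis inv_closed inv_solve_left)
    qed
    \<comment> \<open>Only four candidates remain, so the order is exactly 4 and they are pairwise
      distinct; then \<open>z\<close> is not an involution and generates the group.\<close>
    let ?S = "{\<one>, z, inv z, inv z \<otimes> inv z}"
    have sub: "carrier G \<subseteq> ?S" using y by blast
    have "card ?S \<ge> 4"
      using card card_mono[OF _ sub] by (auto simp: Coset.order_def)
    moreover have "card ?S \<le> 4" by (simp add: card_insert_if)
    ultimately have S4: "card ?S = 4" by simp
    then have o4: "Coset.order G = 4"
      using card card_mono[OF _ sub] by (simp add: Coset.order_def)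
    have ne: "z \<noteq> inv z"
    proof
      assume "z = inv z"
      then have "?S = {\<one>, z, inv z \<otimes> inv z}" by auto
      then show False using S4 by (simp add: card_insert_if split: if_splits)
    qed
    have "ord z = 4"
    proof -
      have "ord z dvd 4" using ord_dvd_group_order[OF z(1)] o4 by simp
      moreover from this have "ord z \<noteq> 0" by (metis dvd_0_left_iff zero_neq_numeral)
      ultimately have "ord z \<le> 4" "ord z \<noteq> 0" "ord z \<noteq> 3"
        using dvd_imp_le by (force, simp, auto)
      moreover have "ord z \<noteq> 1" using z1 ord_eq_1[OF z(1)] by simp
      moreover have "ord z \<noteq> 2"
      proof
        assume "ord z = 2"
        then have "z \<otimes> z = \<one>" using pow_ord_eq_1[OF z(1)] z(1) by (simp add: numeral_2_eq_2)
        then show False using ne z(1) by (metis inv_equality)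
      qed
      ultimately show ?thesis by linarith
    qed
    then show False using iso_integer_mod_group_if_ord[OF z(1) fin] o4 not4 by simp
  qed
  then have "F g = F m" if "g \<in> carrier G" for g
    using that m(1) by (metis f_def diff_eq_eq add_0 inv_closed inv_solve_left m_closed)
  then show ?thesis by blast
qed

section \<open>The lattice of a listed group\<close>

locale listed_group = comm_group G for G (structure) +
  fixes gs :: "'a list"
  assumes finite_carrier: "finite (carrier G)" and listed: "lists_nonzero G gs"
begin

text \<open>Indexing by group elements instead of list positions frees the later arguments from the
  listing. Values outside the carrier are unconstrained.\<close>

definition relation :: "('a \<Rightarrow> int) \<Rightarrow> bool" where
  "relation y \<longleftrightarrow> (\<Sum>g\<in>carrier G. y g) = 0 \<and> (\<Otimes>g\<in>carrier G. g [^] y g) = \<one>"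

text \<open>The identity, whose power is trivial, carries the dependent last coordinate of the lattice.\<close>

definition coords :: "('a \<Rightarrow> int) \<Rightarrow> real vec" where
  "coords y = vec (Suc (length gs)) (\<lambda>i. real_of_int (y ((gs @ [\<one>]) ! i)))"

lemma gs: "distinct gs" "set gs = carrier G - {\<one>}"
  using listed by (auto simp: lists_nonzero_def)

lemma nth_gs: "i < length gs \<Longrightarrow> gs ! i \<in> carrier G" "i < length gs \<Longrightarrow> gs ! i \<noteq> \<one>"
  using gs nth_mem[of i gs] by auto

lemma bij_nth: "bij_betw ((!) (gs @ [\<one>])) {..<Suc (length gs)} (carrier G)"
  using gs by (intro bij_betw_nth) auto

lemma bij_nth_gs: "bij_betw ((!) gs) {..<length gs} (carrier G - {\<one>})"
  using gs by (intro bij_betw_nth) auto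

lemma order_eq: "Coset.order G = Suc (length gs)"
  using bij_betw_same_card[OF bij_nth] by (simp add: Coset.order_def)

lemma coords_carrier [simp]: "coords y \<in> carrier_vec (Suc (length gs))"
  by (simp add: coords_def)

lemma sum_nth: "(\<Sum>i<Suc (length gs). f ((gs @ [\<one>]) ! i)) = (\<Sum>g\<in>carrier G. f g)"
  by (rule sum.reindex_bij_betw[OF bij_nth])

lemma finprod_nth:
  "(\<Otimes>i\<in>{..<length gs}. (gs ! i) [^] y (gs ! i)) = (\<Otimes>g\<in>carrier G. g [^] (y g :: int))"
proof -
  have "(\<Otimes>i\<in>{..<length gs}. (gs ! i) [^] y (gs ! i))
      = (\<Otimes>g\<in>(!) gs ` {..<length gs}. g [^] y g)"
    using gs bij_nth_gs by (intro finprod_reindex[symmetric]) (auto simp: bij_betw_def)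
  also have "(!) gs ` {..<length gs} = carrier G - {\<one>}"
    using bij_nth_gs by (simp add: bij_betw_def)
  also have "(\<Otimes>g\<in>carrier G - {\<one>}. g [^] y g) = (\<Otimes>g\<in>carrier G. g [^] y g)"
    by (rule finprod_mono_neutral_cong_left) (use finite_carrier in auto)
  finally show ?thesis .
qed

lemma group_lattice_eq: "group_lattice G gs = coords ` {y. relation y}"
proof (intro equalityI subsetI)
  fix X assume "X \<in> group_lattice G gs"
  then obtain x :: "nat \<Rightarrow> int" where X: "X = vec (length gs + 1)
       (\<lambda>i. real_of_int (if i < length gs then x i else - (\<Sum>j<length gs. x j)))"
    and x: "(\<Otimes>i\<in>{..<length gs}. (gs ! i) [^] x i) = \<one>"
    unfolding group_lattice_def by auto
  \<comment> \<open>The identity receives the dependent last coordinate; every other element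
    receives the coordinate of its position in the list.\<close>
  define y where "y g = (if g = \<one> then - (\<Sum>j<length gs. x j)
      else x (the_inv_into {..<length gs} ((!) gs) g))" for g
  have y_nth: "y (gs ! i) = x i" if "i < length gs" for i
    using that nth_gs[OF that] bij_nth_gs
    by (simp add: y_def bij_betw_def the_inv_into_f_f)
  have "relation y"
    unfolding relation_def
  proof
    show "(\<Sum>g\<in>carrier G. y g) = 0"
      unfolding sum_nth[symmetric] by (simp add: nth_append y_nth) (simp add: y_def)
    have "(\<Otimes>i\<in>{..<length gs}. (gs ! i) [^] x i) = (\<Otimes>i\<in>{..<length gs}. (gs ! i) [^] y (gs ! i))"
      by (rule finprod_cong'[OF refl]) (simp_all add: y_nth nth_gs)
    then show "(\<Otimes>g\<in>carrier G. g [^] y g) = \<one>" using x finprod_nth by simp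
  qed
  moreover have "X = coords y"
    unfolding X coords_def by (rule eq_vecI) (auto simp: nth_append y_nth, auto simp: y_def)
  ultimately show "X \<in> coords ` {y. relation y}" by blast
next
  fix X assume "X \<in> coords ` {y. relation y}"
  then obtain y where y: "relation y" "X = coords y" by auto
  have s: "- (\<Sum>j<length gs. y (gs ! j)) = y \<one>"
    using y(1) unfolding relation_def sum_nth[symmetric] by (simp add: nth_append)
  have "X = vec (length gs + 1) (\<lambda>i. real_of_int (if i < length gs then y (gs ! i)
      else - (\<Sum>j<length gs. y (gs ! j))))"
    unfolding y(2) coords_def s by (rule eq_vecI) (auto simp: nth_append)
  moreover have "(\<Otimes>i\<in>{..<length gs}. (gs ! i) [^] y (gs ! i)) = \<one>"
    using y(1) finprod_nth by (simp add: relation_def)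
  ultimately show "X \<in> group_lattice G gs"
    unfolding group_lattice_def by (auto intro!: exI[of _ "\<lambda>i. y (gs ! i)"])
qed

text \<open>Functions on \<open>G\<close> serve as dual vectors: \<open>F = y\<close> gives the
  squared norm, and general \<open>F\<close> the annihilator condition.\<close>

lemma coords_scalar_prod:
  "coords y \<bullet> vec (Suc (length gs)) (\<lambda>i. F ((gs @ [\<one>]) ! i))
    = (\<Sum>g\<in>carrier G. y g * F g)"
  unfolding sum_nth[symmetric] scalar_prod_def coords_def
  by (auto simp: lessThan_atLeast0 intro!: sum.cong)

lemma euclidean_norm_coords: "euclidean_norm (coords y) = sqrt (of_int (\<Sum>g\<in>carrier G. (y g)\<^sup>2))"
  unfolding euclidean_norm_def
  by (subst (2) coords_def, subst coords_scalar_prod) (simp add: power2_eq_square)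

lemma coords_eq_0_iff: "coords y = 0\<^sub>v (Suc (length gs)) \<longleftrightarrow> (\<forall>g\<in>carrier G. y g = 0)"
proof -
  have "coords y = 0\<^sub>v (Suc (length gs)) \<longleftrightarrow> (\<forall>i\<in>{..<Suc (length gs)}. y ((gs @ [\<one>]) ! i) = 0)"
    unfolding coords_def by (auto simp: vec_eq_iff)
  also have "\<dots> \<longleftrightarrow> (\<forall>g\<in>carrier G. y g = 0)"
    using bij_nth unfolding bij_betw_def by (metis (no_types, lifting) image_iff)
  finally show ?thesis .
qed

text \<open>The square of the minimum distance, as a predicate on integers: attainment and
  minimality together determine the \<open>LEAST\<close>, and square roots stay out of the
  computations.\<close>

definition minimal_norm2 :: "int \<Rightarrow> bool" where
  "minimal_norm2 m \<longleftrightarrow> (\<exists>y. relation y \<and> (\<Sum>g\<in>carrier G. (y g)\<^sup>2) = m) \<and> 0 < m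
    \<and> (\<forall>y. relation y \<longrightarrow> (\<Sum>g\<in>carrier G. (y g)\<^sup>2) < m \<longrightarrow> (\<forall>g\<in>carrier G. y g = 0))"

lemma minimal_norm2I:
  assumes "relation y" "(\<Sum>g\<in>carrier G. (y g)\<^sup>2) = m" "0 < m"
    and "\<And>z. \<lbrakk>relation z; (\<Sum>g\<in>carrier G. (z g)\<^sup>2) < m\<rbrakk> \<Longrightarrow> \<forall>g\<in>carrier G. z g = 0"
  shows "minimal_norm2 m"
  unfolding minimal_norm2_def using assms(1-3)
  by (intro conjI exI[of _ y] allI impI assms(4))

lemma min_distance_eq:
  assumes "minimal_norm2 m"
  shows "min_distance G gs = sqrt (of_int m)"
  unfolding min_distance_def
proof (rule Least_equality)
  obtain y where y: "relation y" "(\<Sum>g\<in>carrier G. (y g)\<^sup>2) = m"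
    using assms unfolding minimal_norm2_def by blast
  have "m > 0" using assms unfolding minimal_norm2_def by blast
  have "coords y \<noteq> 0\<^sub>v (Suc (length gs))"
  proof
    assume "coords y = 0\<^sub>v (Suc (length gs))"
    then have "(\<Sum>g\<in>carrier G. (y g)\<^sup>2) = 0" by (simp add: coords_eq_0_iff)
    then show False using y(2) \<open>m > 0\<close> by simp
  qed
  then have "coords y \<in> group_lattice G gs - {0\<^sub>v (length gs + 1)}"
    using y by (simp add: group_lattice_eq)
  then show "sqrt (of_int m) \<in> euclidean_norm ` (group_lattice G gs - {0\<^sub>v (length gs + 1)})"
    using euclidean_norm_coords[of y] y(2) by (metis image_eqI)
next
  fix r assume "r \<in> euclidean_norm ` (group_lattice G gs - {0\<^sub>v (length gs + 1)})"
  then obtain y where y: "relation y" "coords y \<noteq> 0\<^sub>v (Suc (length gs))" "r = euclidean_norm (coords y)"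
    by (auto simp: group_lattice_eq)
  then have "m \<le> (\<Sum>g\<in>carrier G. (y g)\<^sup>2)"
    using assms unfolding minimal_norm2_def coords_eq_0_iff by (meson not_le)
  then show "sqrt (of_int m) \<le> r"
    unfolding y(3) euclidean_norm_coords by (intro real_sqrt_le_mono) (simp only: of_int_le_iff)
qed

lemma minimal_vectors_eq:
  assumes "minimal_norm2 m"
  shows "minimal_vectors G gs = coords ` {y. relation y \<and> (\<Sum>g\<in>carrier G. (y g)\<^sup>2) = m}"
  unfolding minimal_vectors_def min_distance_eq[OF assms] group_lattice_eq
  by (auto simp: euclidean_norm_coords simp del: of_int_sum)

text \<open>Restates the duality criterion for functions on \<open>G\<close>, so that no coordinates
  are needed when it is applied.\<close>

lemma well_rounded_if_annihilator_const:
  assumes m: "minimal_norm2 m"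
    and ann: "\<And>F :: 'a \<Rightarrow> real.
      (\<And>y. \<lbrakk>relation y; (\<Sum>g\<in>carrier G. (y g)\<^sup>2) = m\<rbrakk> \<Longrightarrow> (\<Sum>g\<in>carrier G. y g * F g) = 0)
      \<Longrightarrow> \<exists>c. \<forall>g\<in>carrier G. F g = c"
  shows "well_rounded G gs"
  unfolding well_rounded_def Suc_eq_plus1[symmetric]
proof (rule exists_lin_indpt_if_annihilator_const)
  show "minimal_vectors G gs \<subseteq> carrier_vec (Suc (length gs))"
    unfolding minimal_vectors_eq[OF m] by auto
next
  fix V :: "real vec" assume V: "V \<in> carrier_vec (Suc (length gs))"
    "\<And>X. X \<in> minimal_vectors G gs \<Longrightarrow> X \<bullet> V = 0"
  define F where "F g = V $ (the_inv_into {..<Suc (length gs)} ((!) (gs @ [\<one>])) g)" for g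
  have F_nth: "F ((gs @ [\<one>]) ! i) = V $ i" if "i < Suc (length gs)" for i
    unfolding F_def using bij_nth that by (subst the_inv_into_f_f) (auto simp: bij_betw_def)
  have V_eq: "V = vec (Suc (length gs)) (\<lambda>i. F ((gs @ [\<one>]) ! i))"
    by (rule eq_vecI) (use V(1) F_nth in auto)
  have "\<exists>c. \<forall>g\<in>carrier G. F g = c"
  proof (rule ann)
    fix y assume "relation y" "(\<Sum>g\<in>carrier G. (y g)\<^sup>2) = m"
    then have "coords y \<bullet> V = 0" by (intro V(2)) (auto simp: minimal_vectors_eq[OF m])
    then show "(\<Sum>g\<in>carrier G. y g * F g) = 0"
      by (subst (asm) V_eq) (simp only: coords_scalar_prod)
  qed
  then obtain c where "\<forall>g\<in>carrier G. F g = c" ..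
  then have "\<forall>i<Suc (length gs). V $ i = c"
    using F_nth bij_nth by (metis bij_betw_apply lessThan_iff)
  then show "\<exists>c. \<forall>i<Suc (length gs). V $ i = c" ..
qed

end

section \<open>Minimal vectors\<close>

context listed_group
begin

lemma relation_norm2_less_4:
  assumes y: "relation y" and less: "(\<Sum>g\<in>carrier G. (y g)\<^sup>2) < 4"
  shows "\<forall>g\<in>carrier G. y g = 0"
proof (rule ccontr)
  assume nz: "\<not> ?thesis"
  have sum0: "(\<Sum>g\<in>carrier G. y g) = 0" using y by (simp add: relation_def)
  \<comment> \<open>A nonzero weight of total zero takes both signs.\<close>
  obtain a where a: "a \<in> carrier G" "y a > 0"
  proof (rule ccontr)
    assume "\<not> thesis"
    then have "\<forall>g\<in>carrier G. 0 \<le> - y g" using that by force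
    then have "\<forall>g\<in>carrier G. - y g = 0"
      using sum0 finite_carrier by (subst sum_nonneg_eq_0_iff[symmetric]) (auto simp: sum_negf)
    then show False using nz by simp
  qed
  obtain b where b: "b \<in> carrier G" "y b < 0"
  proof (rule ccontr)
    assume "\<not> thesis"
    then have "\<forall>g\<in>carrier G. 0 \<le> y g" using that by force
    then have "\<forall>g\<in>carrier G. y g = 0"
      using sum0 finite_carrier by (subst sum_nonneg_eq_0_iff[symmetric]) auto
    then show False using nz by simp
  qed
  have ab: "a \<noteq> b" using a b by auto
  define R where "R = (\<Sum>g\<in>carrier G - {a, b}. (y g)\<^sup>2)"
  have split: "(\<Sum>g\<in>carrier G. (y g)\<^sup>2) = (y a)\<^sup>2 + (y b)\<^sup>2 + R"
    unfolding R_def using finite_carrier a b ab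
    by (subst sum.subset_diff[of "{a, b}"]) auto
  have "R \<ge> 0" unfolding R_def by (intro sum_nonneg) auto
  \<comment> \<open>Each \<open>u\<^sup>2 - u\<close> is even, so the squared norm has the parity of
    the total weight.\<close>
  have "even (\<Sum>g\<in>carrier G. (y g)\<^sup>2 - y g)" by (intro dvd_sum) auto
  then have "even (\<Sum>g\<in>carrier G. (y g)\<^sup>2)" using sum0 by (simp add: sum_subtractf)
  then have "(\<Sum>g\<in>carrier G. (y g)\<^sup>2) \<le> 2" using less by presburger
  moreover have "y a \<le> (y a)\<^sup>2" "- y b \<le> (y b)\<^sup>2"
    using self_le_power[of "y a" 2] self_le_power[of "- y b" 2] a b by auto
  \<comment> \<open>The values at \<open>a\<close> and \<open>b\<close> contribute at least 1 each,
    which exhausts the bound 2.\<close>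
  ultimately have vals: "y a = 1" "y b = - 1" "R = 0"
    using split \<open>R \<ge> 0\<close> a(2) b(2) by linarith+
  have rest: "\<forall>g\<in>carrier G - {a, b}. y g = 0"
    using vals(3) finite_carrier unfolding R_def by (subst (asm) sum_nonneg_eq_0_iff) auto
  have "(\<Otimes>g\<in>carrier G. g [^] y g) = (\<Otimes>g\<in>{a, b}. g [^] y g)"
    by (rule finprod_mono_neutral_cong_right) (use finite_carrier a b rest in auto)
  also have "\<dots> = a \<otimes> inv b"
    using a b ab vals by (simp add: int_pow_neg int_pow_1)
  finally have "a \<otimes> inv b = \<one>" using y by (simp add: relation_def)
  then show False using a b ab by (metis inv_closed inv_equality inv_inv)
qed

definition quad :: "'a \<Rightarrow> 'a \<Rightarrow> 'a \<Rightarrow> 'a \<Rightarrow> 'a \<Rightarrow> int" where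
  "quad a b c d g = (if g \<in> {a, b} then 1 else if g \<in> {c, d} then - 1 else 0)"

text \<open>The general summand \<open>h\<close> lets one computation serve the total weight, the
  squared norm and the pairing with \<open>F\<close>.\<close>

lemma sum_quad:
  fixes h :: "'a \<Rightarrow> int \<Rightarrow> 'c::comm_monoid_add"
  assumes "{a, b, c, d} \<subseteq> carrier G" "distinct [a, b, c, d]" "\<And>g. h g 0 = 0"
  shows "(\<Sum>g\<in>carrier G. h g (quad a b c d g)) = h a 1 + (h b 1 + (h c (- 1) + h d (- 1)))"
proof -
  have "(\<Sum>g\<in>carrier G. h g (quad a b c d g)) = (\<Sum>g\<in>{a, b, c, d}. h g (quad a b c d g))"
    by (rule sum.mono_neutral_right) (use assms finite_carrier in \<open>auto simp: quad_def\<close>)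
  also have "\<dots> = h a 1 + (h b 1 + (h c (- 1) + h d (- 1)))"
    using assms(2) by (auto simp: quad_def)
  finally show ?thesis .
qed

lemma relation_quad:
  assumes "{a, b, c, d} \<subseteq> carrier G" "distinct [a, b, c, d]" "a \<otimes> b = c \<otimes> d"
  shows "relation (quad a b c d)"
  unfolding relation_def
proof
  show "(\<Sum>g\<in>carrier G. quad a b c d g) = 0"
    using sum_quad[of a b c d "\<lambda>g k. k"] assms by simp
  have "(\<Otimes>g\<in>carrier G. g [^] quad a b c d g) = (\<Otimes>g\<in>{a, b, c, d}. g [^] quad a b c d g)"
    by (rule finprod_mono_neutral_cong_right) (use assms finite_carrier in \<open>auto simp: quad_def\<close>)
  also have "\<dots> = a \<otimes> (b \<otimes> (inv c \<otimes> inv d))"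
    using assms(1,2) by (auto simp: quad_def int_pow_neg int_pow_1)
  also have "\<dots> = (a \<otimes> b) \<otimes> inv (c \<otimes> d)"
    using assms(1) by (simp add: inv_mult m_assoc)
  also have "\<dots> = \<one>"
    unfolding assms(3) using assms(1) by simp
  finally show "(\<Otimes>g\<in>carrier G. g [^] quad a b c d g) = \<one>" .
qed

lemma norm2_quad:
  assumes "{a, b, c, d} \<subseteq> carrier G" "distinct [a, b, c, d]"
  shows "(\<Sum>g\<in>carrier G. (quad a b c d g)\<^sup>2) = 4"
  using sum_quad[of a b c d "\<lambda>g k. k\<^sup>2"] assms by simp

lemma minimal_norm2_4_if_quad:
  assumes "{a, b, c, d} \<subseteq> carrier G" "distinct [a, b, c, d]" "a \<otimes> b = c \<otimes> d"
  shows "minimal_norm2 4"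
  by (rule minimal_norm2I[OF relation_quad[OF assms] norm2_quad[OF assms(1,2)]])
    (simp, rule relation_norm2_less_4)

text \<open>A quadruple exists without being constructed: otherwise the balance condition would hold
  vacuously for the indicator of the identity, which is not constant.\<close>

lemma minimal_norm2_4:
  assumes "Coset.order G \<ge> 4" "\<not> G \<cong> integer_mod_group 4"
  shows "minimal_norm2 4"
proof (rule ccontr)
  assume no: "\<not> ?thesis"
  obtain g where g: "g \<in> carrier G" "g \<noteq> \<one>"
  proof (rule ccontr)
    assume "\<not> thesis"
    then have "carrier G \<subseteq> {\<one>}" using that by blast
    then have "card (carrier G) \<le> 1" using card_mono[of "{\<one>}"] by simp
    then show False using assms(1) by (simp add: Coset.order_def)
  qed
  obtain c where "\<forall>g\<in>carrier G. (if g = \<one> then 1 else 0) = (c :: real)"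
    using const_if_balanced_on_quads[OF finite_carrier assms, of "\<lambda>g. if g = \<one> then 1 else 0"]
      minimal_norm2_4_if_quad no by blast
  then show False using g one_closed by (metis zero_neq_one)
qed

text \<open>Orthogonality to the vectors \<open>quad a b c d\<close> alone already gives the balance
  condition.\<close>

lemma well_rounded_if_order_ge_4:
  assumes "Coset.order G \<ge> 4" "\<not> G \<cong> integer_mod_group 4"
  shows "well_rounded G gs"
proof (rule well_rounded_if_annihilator_const[OF minimal_norm2_4[OF assms]])
  fix F :: "'a \<Rightarrow> real"
  assume F: "\<And>y. \<lbrakk>relation y; (\<Sum>g\<in>carrier G. (y g)\<^sup>2) = 4\<rbrakk> \<Longrightarrow> (\<Sum>g\<in>carrier G. y g * F g) = 0"
  show "\<exists>c. \<forall>g\<in>carrier G. F g = c"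
  proof (rule const_if_balanced_on_quads[OF finite_carrier assms])
    fix a b c d assume q: "{a, b, c, d} \<subseteq> carrier G" "distinct [a, b, c, d]" "a \<otimes> b = c \<otimes> d"
    have "(\<Sum>g\<in>carrier G. quad a b c d g * F g) = 0"
      using F relation_quad[OF q] norm2_quad[OF q(1,2)] by blast
    then show "F a + F b = F c + F d"
      using sum_quad[of a b c d "\<lambda>g k. of_int k * F g"] q by simp
  qed
qed

end

text \<open>Here \<open>a, b, c, d\<close> are the weights of the powers 0 to 3 of a generator.
  Total zero leaves two entries 1 and two entries -1, and the congruence excludes equal signs at
  exponents 0 and 2. The two linear equations confine the minimal vectors to a plane.\<close>

lemma norm2_4_mod_4_relation:
  fixes a b c d :: int
  assumes "a + b + c + d = 0" "4 dvd b + 2 * c + 3 * d" "a\<^sup>2 + b\<^sup>2 + c\<^sup>2 + d\<^sup>2 = 4"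
  shows "c = - a \<and> d = - b \<and> a\<^sup>2 = 1 \<and> b\<^sup>2 = 1"
proof -
  have bd: "u \<in> {-2, -1, 0, 1, 2}" if "u\<^sup>2 \<le> 4" for u :: int
  proof -
    have "\<bar>u\<bar> \<le> 2" using that power2_le_iff_abs_le[of 2 u] by simp
    then show ?thesis by auto
  qed
  have nn: "a\<^sup>2 \<ge> 0" "b\<^sup>2 \<ge> 0" "c\<^sup>2 \<ge> 0" "d\<^sup>2 \<ge> 0" by auto
  \<comment> \<open>The last entry is determined by the others, so finitely many cases can be
    checked.\<close>
  have "a \<in> {-2, -1, 0, 1, 2}" "b \<in> {-2, -1, 0, 1, 2}" "c \<in> {-2, -1, 0, 1, 2}"
    using nn assms(3) by (intro bd; linarith)+
  moreover have "d = - a - b - c" using assms(1) by simp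
  ultimately show ?thesis using assms(2,3) by (elim insertE emptyE; simp)
qed

section \<open>Cyclic groups of order two, three and four\<close>

locale listed_cyclic_group = listed_group +
  fixes x assumes x: "x \<in> carrier G" and ord_x: "ord x = Coset.order G"
begin

definition gen_pow :: "nat \<Rightarrow> 'a" where
  "gen_pow i = x [^] i"

lemma gen_pow_carrier: "gen_pow i \<in> carrier G"
  using x by (simp add: gen_pow_def)

lemma bij_gen_pow: "bij_betw gen_pow {..<Coset.order G} (carrier G)"
proof -
  have "0 < Coset.order G" using finite_carrier by (simp add: order_gt_0_iff_finite)
  then have "{0..ord x - 1} = {..<Coset.order G}" using ord_x by auto
  then have inj: "inj_on gen_pow {..<Coset.order G}"
    using ord_inj[OF x] by (simp add: gen_pow_def inj_on_def)
  have "gen_pow ` {..<Coset.order G} = carrier G"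
    by (rule card_subset_eq)
      (use inj gen_pow_carrier finite_carrier in \<open>auto simp: card_image Coset.order_def\<close>)
  then show ?thesis using inj by (simp add: bij_betw_def)
qed

lemma sum_carrier_eq: "(\<Sum>g\<in>carrier G. h g) = (\<Sum>i<Coset.order G. h (gen_pow i))"
  by (rule sum.reindex_bij_betw[OF bij_gen_pow, symmetric])

text \<open>Writing all elements as powers of \<open>x\<close> turns the product condition into one
  congruence on exponents.\<close>

lemma relation_iff:
  "relation y \<longleftrightarrow> (\<Sum>i<Coset.order G. y (gen_pow i)) = 0
    \<and> int (Coset.order G) dvd (\<Sum>i<Coset.order G. int i * y (gen_pow i))"
proof -
  have "(\<Otimes>g\<in>carrier G. g [^] y g) = (\<Otimes>i\<in>{..<Coset.order G}. gen_pow i [^] y (gen_pow i))"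
    using bij_gen_pow gen_pow_carrier unfolding bij_betw_def
    by (subst finprod_reindex[symmetric]) auto
  also have "\<dots> = x [^] (\<Sum>i<Coset.order G. int i * y (gen_pow i))"
  proof -
    have "(\<Otimes>i\<in>A. gen_pow i [^] y (gen_pow i)) = x [^] (\<Sum>i\<in>A. int i * y (gen_pow i))"
      if "finite A" for A
      using that
    proof (induction A rule: finite_induct)
      case (insert i A)
      have "gen_pow i [^] y (gen_pow i) = x [^] (int i * y (gen_pow i))"
        using x by (simp add: gen_pow_def int_pow_int[symmetric] int_pow_pow)
      then show ?case
        using insert x gen_pow_carrier by (subst finprod_insert) (auto simp: int_pow_mult)
    qed simp
    then show ?thesis by simp
  qed
  finally show ?thesis
    unfolding relation_def sum_carrier_eq int_pow_eq_id[OF x, symmetric] ord_x[symmetric] by simp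
qed

text \<open>Supplies explicit witnesses: weights may be prescribed exponent by exponent.\<close>

lemma exists_gen_pow_values: "\<exists>y :: 'a \<Rightarrow> 'c. \<forall>i<Coset.order G. y (gen_pow i) = z i"
proof (intro exI allI impI)
  fix i assume "i < Coset.order G"
  then show "z (the_inv_into {..<Coset.order G} gen_pow (gen_pow i)) = z i"
    using bij_gen_pow by (subst the_inv_into_f_f) (auto simp: bij_betw_def)
qed

lemma ball_carrier_iff: "(\<forall>g\<in>carrier G. P g) \<longleftrightarrow> (\<forall>i<Coset.order G. P (gen_pow i))"
  unfolding bij_betw_imp_surj_on[OF bij_gen_pow, symmetric] by auto

text \<open>The lattice consists of the integer multiples of \<open>(- 2, 2)\<close>, and
  orthogonality to this vector already makes \<open>F\<close> constant.\<close>

lemma order_2: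
  assumes o: "Coset.order G = 2"
  shows "minimal_norm2 8" "well_rounded G gs"
proof -
  obtain y :: "'a \<Rightarrow> int" where "\<forall>i<Coset.order G. y (gen_pow i) = (if i = 0 then - 2 else 2)"
    using exists_gen_pow_values[of "\<lambda>i. if i = 0 then - 2 else 2"] by blast
  then have y: "y (gen_pow 0) = - 2" "y (gen_pow 1) = 2"
    using o by auto
  then have y2: "relation y" "(\<Sum>g\<in>carrier G. (y g)\<^sup>2) = 8"
    unfolding relation_iff sum_carrier_eq o by (auto simp: numeral_2_eq_2)
  have "\<forall>g\<in>carrier G. z g = 0" if z: "relation z" "(\<Sum>g\<in>carrier G. (z g)\<^sup>2) < 8" for z
  proof -
    define a b where ab: "a = z (gen_pow 0)" "b = z (gen_pow 1)"
    have "a + b = 0" "2 dvd b" "a\<^sup>2 + b\<^sup>2 < 8"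
      using z unfolding relation_iff sum_carrier_eq o by (auto simp: numeral_2_eq_2 ab)
    obtain k where "b = 2 * k" using \<open>2 dvd b\<close> by (rule dvdE)
    then have k: "b = 2 * k" "a = - 2 * k" using \<open>a + b = 0\<close> by auto
    then have "k\<^sup>2 < 1" using \<open>a\<^sup>2 + b\<^sup>2 < 8\<close> by (simp add: power_mult_distrib)
    then have "k = 0" by (smt (verit) zero_less_power2)
    then show ?thesis
      unfolding ball_carrier_iff o using k by (auto simp: ab less_2_cases_iff)
  qed
  then show m: "minimal_norm2 8" by (intro minimal_norm2I[OF y2]) simp_all
  show "well_rounded G gs"
  proof (rule well_rounded_if_annihilator_const[OF m])
    fix F :: "'a \<Rightarrow> real"
    assume "\<And>y. \<lbrakk>relation y; (\<Sum>g\<in>carrier G. (y g)\<^sup>2) = 8\<rbrakk> \<Longrightarrow> (\<Sum>g\<in>carrier G. y g * F g) = 0"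
    from this[OF y2] have "F (gen_pow 0) = F (gen_pow 1)"
      unfolding sum_carrier_eq o using y by (simp add: numeral_2_eq_2)
    then show "\<exists>c. \<forall>g\<in>carrier G. F g = c"
      unfolding ball_carrier_iff o by (metis less_2_cases One_nat_def)
  qed
qed

text \<open>The vectors \<open>(1, 1, - 2)\<close> and \<open>(1, - 2, 1)\<close> attain the
  minimum, and only constants are orthogonal to both.\<close>

lemma order_3:
  assumes o: "Coset.order G = 3"
  shows "minimal_norm2 6" "well_rounded G gs"
proof -
  have sum3: "(\<Sum>i<3. f i) = f 0 + f 1 + f (2::nat)" for f :: "nat \<Rightarrow> 'c::comm_monoid_add"
    by (simp add: numeral_3_eq_3 numeral_2_eq_2)
  have all3: "(\<forall>i<3. P i) \<longleftrightarrow> P 0 \<and> P 1 \<and> P (2::nat)" for P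
    by (auto simp: All_less_Suc eval_nat_numeral)
  obtain y :: "'a \<Rightarrow> int" where "\<forall>i<Coset.order G. y (gen_pow i) = (if i = 2 then - 2 else 1)"
    using exists_gen_pow_values[of "\<lambda>i. if i = 2 then - 2 else 1"] by blast
  then have y: "y (gen_pow 0) = 1" "y (gen_pow 1) = 1" "y (gen_pow 2) = - 2"
    using o by auto
  then have y2: "relation y" "(\<Sum>g\<in>carrier G. (y g)\<^sup>2) = 6"
    unfolding relation_iff sum_carrier_eq o sum3 y by auto
  obtain w :: "'a \<Rightarrow> int" where "\<forall>i<Coset.order G. w (gen_pow i) = (if i = 1 then - 2 else 1)"
    using exists_gen_pow_values[of "\<lambda>i. if i = 1 then - 2 else 1"] by blast
  then have w: "w (gen_pow 0) = 1" "w (gen_pow 1) = - 2" "w (gen_pow 2) = 1"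
    using o by auto
  then have w2: "relation w" "(\<Sum>g\<in>carrier G. (w g)\<^sup>2) = 6"
    unfolding relation_iff sum_carrier_eq o sum3 w by auto
  have "\<forall>g\<in>carrier G. z g = 0" if z: "relation z" "(\<Sum>g\<in>carrier G. (z g)\<^sup>2) < 6" for z
  proof -
    define a b c where abc: "a = z (gen_pow 0)" "b = z (gen_pow 1)" "c = z (gen_pow 2)"
    have h: "a + b + c = 0" "3 dvd b + 2 * c" "a\<^sup>2 + b\<^sup>2 + c\<^sup>2 < 6"
      using z unfolding relation_iff sum_carrier_eq o sum3 abc by auto
    then obtain k where k: "b = 3 * k - 2 * c" by (auto simp: dvd_def algebra_simps)
    then have a: "a = c - 3 * k" using h(1) by simp
    \<comment> \<open>Completing the square shows definiteness; the next identity shows that the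
      squared norm is a multiple of 6, so below 6 it is at most 0.\<close>
    have "4 * (a\<^sup>2 + b\<^sup>2 + c\<^sup>2) = 6 * ((2 * c - 3 * k)\<^sup>2 + 3 * k\<^sup>2)"
      unfolding a k by (simp add: power2_eq_square algebra_simps)
    moreover have "a\<^sup>2 + b\<^sup>2 + c\<^sup>2 = 6 * (c\<^sup>2 - 3 * k * c + 3 * k\<^sup>2)"
      unfolding a k by (simp add: power2_eq_square algebra_simps)
    ultimately have "(2 * c - 3 * k)\<^sup>2 + 3 * k\<^sup>2 \<le> 0" using h(3) by presburger
    then have "(2 * c - 3 * k)\<^sup>2 = 0 \<and> k\<^sup>2 = 0"
      using zero_le_power2[of "2 * c - 3 * k"] zero_le_power2[of k] by linarith
    then have "k = 0" "c = 0" by auto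
    then show ?thesis
      unfolding ball_carrier_iff o all3 using k a abc by auto
  qed
  then show m: "minimal_norm2 6" by (intro minimal_norm2I[OF y2]) simp_all
  show "well_rounded G gs"
  proof (rule well_rounded_if_annihilator_const[OF m])
    fix F :: "'a \<Rightarrow> real"
    assume F: "\<And>y. \<lbrakk>relation y; (\<Sum>g\<in>carrier G. (y g)\<^sup>2) = 6\<rbrakk> \<Longrightarrow> (\<Sum>g\<in>carrier G. y g * F g) = 0"
    have "F (gen_pow 1) = F (gen_pow 0) \<and> F (gen_pow 2) = F (gen_pow 0)"
      using F[OF y2] F[OF w2] unfolding sum_carrier_eq o sum3 y w by simp
    then show "\<exists>c. \<forall>g\<in>carrier G. F g = c"
      unfolding ball_carrier_iff o all3 by metis
  qed
qed

text \<open>The minimal vectors have the form \<open>(a, b, - a, - b)\<close> with signs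
  \<open>a\<close> and \<open>b\<close>. They form two opposite pairs, so three of them are never
  independent, while the rank is three.\<close>

lemma order_4:
  assumes o: "Coset.order G = 4"
  shows "minimal_norm2 4" "\<not> well_rounded G gs"
proof -
  have sum4: "(\<Sum>i<4. f i) = f 0 + f 1 + f 2 + f (3::nat)" for f :: "nat \<Rightarrow> 'c::comm_monoid_add"
    by (simp add: eval_nat_numeral)
  have all4: "(\<forall>i<4. P i) \<longleftrightarrow> P 0 \<and> P 1 \<and> P 2 \<and> P (3::nat)" for P
    by (auto simp: All_less_Suc eval_nat_numeral)
  have signs: "c = a \<and> d = b \<or> c = - a \<and> d = - b"
    if "a\<^sup>2 = 1" "b\<^sup>2 = 1" "c\<^sup>2 = 1" "d\<^sup>2 = 1" "a * b = c * d" for a b c d :: int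
    using that by (auto simp: power2_eq_1_iff)
  have inj: "gen_pow i = gen_pow j \<longleftrightarrow> i = j" if "i < 4" "j < 4" for i j :: nat
    using bij_gen_pow that o by (auto simp: bij_betw_def inj_on_def)
  \<comment> \<open>From \<open>0 + 3 = 1 + 2\<close>: the value 4 is attained here as well.\<close>
  have "gen_pow 0 \<otimes> gen_pow 3 = gen_pow 1 \<otimes> gen_pow 2"
    unfolding gen_pow_def nat_pow_mult[OF x] by (rule arg_cong[where f = "\<lambda>i. x [^] i"]) simp
  then show m: "minimal_norm2 4"
    by (rule minimal_norm2_4_if_quad[rotated 2]) (simp_all add: inj gen_pow_carrier)
  show "\<not> well_rounded G gs"
  proof
    assume "well_rounded G gs"
    interpret vec_space "TYPE(real)" "Suc (length gs)" .
    obtain B where B: "B \<subseteq> minimal_vectors G gs" "card B = 3" "lin_indpt B"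
      using \<open>well_rounded G gs\<close> order_eq o unfolding well_rounded_def by auto
    have "\<forall>X\<in>B. \<exists>y. X = coords y \<and> relation y \<and> (\<Sum>g\<in>carrier G. (y g)\<^sup>2) = 4"
      using B(1) unfolding minimal_vectors_eq[OF m] by blast
    then obtain Y where Y: "\<And>X. X \<in> B \<Longrightarrow> X = coords (Y X)" "\<And>X. X \<in> B \<Longrightarrow> relation (Y X)"
      "\<And>X. X \<in> B \<Longrightarrow> (\<Sum>g\<in>carrier G. (Y X g)\<^sup>2) = 4" by metis
    have vals: "Y X (gen_pow 2) = - Y X (gen_pow 0) \<and> Y X (gen_pow 3) = - Y X (gen_pow 1)
        \<and> (Y X (gen_pow 0))\<^sup>2 = 1 \<and> (Y X (gen_pow 1))\<^sup>2 = 1" if "X \<in> B" for X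
      using Y(2,3)[OF that] unfolding relation_iff sum_carrier_eq o sum4
      by (intro norm2_4_mod_4_relation) auto
    \<comment> \<open>The product of the two free signs tells the opposite pairs apart. It has two
      values, so two of three vectors share one and must be opposite.\<close>
    define p where "p X = Y X (gen_pow 0) * Y X (gen_pow 1)" for X
    have "(p X)\<^sup>2 = 1" if "X \<in> B" for X
      using vals[OF that] by (simp add: p_def power_mult_distrib)
    then have "p ` B \<subseteq> {1, -1}" by (auto simp: power2_eq_1_iff)
    then have "card (p ` B) \<le> 2" using card_mono[of "{1, -1 :: int}" "p ` B"] by simp
    then have "\<not> inj_on p B" using B(2) card_image by fastforce
    then obtain X Z where XZ: "X \<in> B" "Z \<in> B" "X \<noteq> Z" "p X = p Z" by (auto simp: inj_on_def)
    have sign: "(\<forall>g\<in>carrier G. Y Z g = Y X g) \<or> (\<forall>g\<in>carrier G. Y Z g = - Y X g)"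
    proof -
      have "Y Z (gen_pow 0) = Y X (gen_pow 0) \<and> Y Z (gen_pow 1) = Y X (gen_pow 1)
        \<or> Y Z (gen_pow 0) = - Y X (gen_pow 0) \<and> Y Z (gen_pow 1) = - Y X (gen_pow 1)"
      proof (rule signs)
        show "Y X (gen_pow 0) * Y X (gen_pow 1) = Y Z (gen_pow 0) * Y Z (gen_pow 1)"
          using XZ(4) by (simp only: p_def)
      qed (use vals XZ(1,2) in blast)+
      then show ?thesis
        unfolding ball_carrier_iff o all4 using vals[OF XZ(1)] vals[OF XZ(2)]
        by (elim disjE; elim conjE; simp)
    qed
    have cong: "coords y = coords z" if "\<forall>g\<in>carrier G. y g = z g" for y z
      unfolding coords_def using that bij_nth by (auto simp: vec_eq_iff bij_betw_def)
    have neg: "coords (\<lambda>g. - Y X g) = - coords (Y X)"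
      by (auto simp: coords_def vec_eq_iff)
    have X: "coords (Y X) = X" and Z: "coords (Y Z) = Z"
      by (rule Y(1)[OF XZ(1), symmetric], rule Y(1)[OF XZ(2), symmetric])
    have "Z = - X"
      using sign
    proof
      assume "\<forall>g\<in>carrier G. Y Z g = Y X g"
      then have "Z = X" using cong[of "Y Z" "Y X"] by (simp only: X Z)
      then show ?thesis using XZ(3) by simp
    next
      assume "\<forall>g\<in>carrier G. Y Z g = - Y X g"
      then show ?thesis using cong[of "Y Z" "\<lambda>g. - Y X g"] by (simp only: X Z neg)
    qed
    moreover have "X \<in> carrier_vec (Suc (length gs))"
      using coords_carrier[of "Y X"] by (simp only: X)
    ultimately have "lin_dep B"
      using XZ by (intro lin_dep_if_uminus_mem[of X]) auto
    then show False using B(3) by simp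
  qed
qed

end

section \<open>Case distinction on the order of the group\<close>

theorem theorem1p2:
  fixes G :: "('a, 'b) monoid_scheme" and gs :: "'a list"
  assumes "comm_group G"
    and "finite (carrier G)"
    and "carrier G \<noteq> {\<one>\<^bsub>G\<^esub>}"
    and "lists_nonzero G gs"
  shows "(G \<cong> integer_mod_group 4 \<longrightarrow> \<not> well_rounded G gs) \<and>
    (\<not> G \<cong> integer_mod_group 4 \<longrightarrow> well_rounded G gs) \<and>
    (G \<cong> integer_mod_group 2 \<longrightarrow> min_distance G gs = sqrt 8) \<and>
    (G \<cong> integer_mod_group 3 \<longrightarrow> min_distance G gs = sqrt 6) \<and>
    (\<not> G \<cong> integer_mod_group 2 \<and> \<not> G \<cong> integer_mod_group 3 \<longrightarrow> min_distance G gs = 2)"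
proof -
  interpret comm_group G by fact
  interpret listed_group G gs by unfold_locales (fact assms)+
  let ?n = "Coset.order G"
  have "card (carrier G) \<noteq> 0" using assms(2) by auto
  moreover have "card (carrier G) \<noteq> 1"
    using assms(3) one_closed by (metis card_1_singletonE singletonD)
  ultimately have n: "?n = 2 \<or> ?n = 3 \<or> ?n \<ge> 4" by (auto simp: Coset.order_def)
  have iso: "G \<cong> integer_mod_group k \<Longrightarrow> ?n = k" if "k > 0" for k
    using order_iso_integer_mod_group that by blast
  have cyclic: "listed_cyclic_group G gs z" if "z \<in> carrier G" "ord z = ?n" for z
    using that by unfold_locales
  \<comment> \<open>Orders 2 and 3 are prime, hence cyclic; from 4 on only the cyclic group of order
    4 is set apart.\<close>
  consider (two) "?n = 2" "G \<cong> integer_mod_group 2" | (three) "?n = 3" "G \<cong> integer_mod_group 3"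
    | (four) "?n = 4" "G \<cong> integer_mod_group 4" | (other) "?n \<ge> 4" "\<not> G \<cong> integer_mod_group 4"
    using n iso_integer_mod_group_if_prime_order iso[of 4] by fastforce
  then show ?thesis
  proof cases
    case two
    then obtain z where "z \<in> carrier G" "ord z = ?n" using obtain_generator[of 2] by auto
    then interpret listed_cyclic_group G gs z by (rule cyclic)
    show ?thesis using order_2 min_distance_eq[of 8] two iso[of 3] iso[of 4] by auto
  next
    case three
    then obtain z where "z \<in> carrier G" "ord z = ?n" using obtain_generator[of 3] by auto
    then interpret listed_cyclic_group G gs z by (rule cyclic)
    show ?thesis using order_3 min_distance_eq[of 6] three iso[of 2] iso[of 4] by auto
  next
    case four
    then obtain z where "z \<in> carrier G" "ord z = ?n" using obtain_generator[of 4] by auto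
    then interpret listed_cyclic_group G gs z by (rule cyclic)
    show ?thesis using order_4 min_distance_eq[of 4] four iso[of 2] iso[of 3] by auto
  next
    case other
    then show ?thesis
      using well_rounded_if_order_ge_4 minimal_norm2_4 min_distance_eq[of 4] iso[of 2] iso[of 3] by auto
  qed
qed

end
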